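(* For every positive integer $d$ there exists $c(d)>0$, and for every $\alpha\in(0,1)$ there exists $\beta=\beta(d,\alpha)>0$, such that the following holds. Let $\mathcal{F}$ be a family of $n$ convex sets in $\mathbb{R}^d$ such that at least $\alpha\binom{n}{d+1}$ of the $(d+1)$-element subfamilies of $\mathcal{F}$ have an intersection of diameter at least $1$. Then one can find at least $\beta n$ members of $\mathcal{F}$ whose common intersection has diameter at least $c(d)$.
   Context: Diameter is with respect to the Euclidean metric.
   Formalization: The family is assumed to have n ≥ d+1 members; for 1 ≤ n ≤ d the hypothesis on (d+1)-element subfamilies is vacuous (the binomial coefficient is 0) and the claim fails, e.g. for a single one-point set. *)

theory Defs
  imports "HOL-Analysis.Analysis"
begin

text \<open>Euclidean diameter as an extended real: supremum of pairwise distances.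
  It is \<open>\<infinity>\<close> for unbounded sets and \<open>-\<infinity>\<close> for the empty set
  (so the empty set never has diameter at least a positive number).\<close>
definition ediam :: "'a::metric_space set \<Rightarrow> ereal" where
  "ediam S = (SUP p\<in>S \<times> S. ereal (dist (fst p) (snd p)))"

end

theory Submission
  imports Defs
begin

text \<open>
  A set of diameter at least 1 is wide in the direction of some coordinate vector \<open>b\<close>, so by
  pigeonhole a positive fraction of the \<open>(d+1)\<close>-tuples have an intersection that is wide in one fixed
  direction. Having two points \<open>p\<close>, \<open>q\<close> with \<open>(q - p) \<bullet> b \<ge> c\<close> is a nonempty-intersection
  property of convex sets in \<open>\<real>\<^sup>d \<times> \<real>\<^sup>d\<close>, so the fractional Helly theorem there gives the claim
  once a positive fraction of the \<open>(2d+1)\<close>-tuples are wide.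

  To pass from \<open>(d+1)\<close>-tuples to \<open>(2d+1)\<close>-tuples, supersaturation reduces to finding a single wide
  \<open>(2d+1)\<close>-tuple inside a dense hypergraph of bounded size, which contains a large complete
  \<open>(d+1)\<close>-partite grid by a theorem of Erdos. In the grid, apply the colorful Helly
  theorem repeatedly: it gives a color class with a common point \<open>y\<close>; a slab around \<open>y\<close> is removed,
  and after passing to a subgrid all rainbow intersections are still wide on one side of the slab.
  After \<open>d+2\<close> rounds some class has been found twice, and the two points it contains are far apart.
\<close>

subsection \<open>Colorful and fractional Helly theorems\<close>

text \<open>In dimension d, the point of an intersection of d + 1 sets closest to \<open>a\<close>
  is already determined by d of them. This localization of the optimum drives both the colorful and
  the fractional Helly theorem below.\<close>

lemma critical_index:
  fixes F :: "'i \<Rightarrow> 'a::euclidean_space set"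
  assumes I: "card I = DIM('a) + 1"
    and cc: "\<And>i. i \<in> I \<Longrightarrow> convex (F i)" "\<And>i. i \<in> I \<Longrightarrow> closed (F i)"
    and ne: "(\<Inter>i\<in>I. F i) \<noteq> {}"
  shows "\<exists>j\<in>I. closest_point (\<Inter>i\<in>I - {j}. F i) a = closest_point (\<Inter>i\<in>I. F i) a"
proof -
  define v where "v = closest_point (\<Inter>i\<in>I. F i) a"
  have finI: "finite I" using I by (simp add: card_ge_0_finite)
  have cl: "closed (\<Inter>i\<in>T. F i)" "convex (\<Inter>i\<in>T. F i)" if "T \<subseteq> I" for T
    using that cc by (auto intro!: closed_INT convex_INT)
  have v: "v \<in> (\<Inter>i\<in>I. F i)" "\<And>y. y \<in> (\<Inter>i\<in>I. F i) \<Longrightarrow> dist a v \<le> dist a y"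
    unfolding v_def using closest_point_exists[OF cl(1)[OF subset_refl] ne] by blast+
  show ?thesis
  proof (cases "inj_on F I")
    \<comment> \<open>\<open>Helly\<close> speaks of a set of sets, so families with repeated
      members are treated first; dropping a repeated member leaves the intersection
      unchanged.\<close>
    case False
    then obtain i j where ij: "i \<in> I" "j \<in> I" "i \<noteq> j" "F i = F j"
      by (auto simp: inj_on_def)
    have "(\<Inter>i\<in>I - {j}. F i) = (\<Inter>i\<in>I. F i)"
      using ij by blast
    then show ?thesis using ij(2) by metis
  next
    case True
    \<comment> \<open>Apply Helly's theorem to the family enlarged by the ball \<open>B\<close>, which misses the intersection.\<close>
    define B where "B = ball a (dist a v)"
    have "\<exists>j\<in>I. (\<Inter>i\<in>I - {j}. F i) \<inter> B = {}"
    proof (rule ccontr)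
      assume "\<not> ?thesis"
      then have meet: "(\<Inter>i\<in>I - {j}. F i) \<inter> B \<noteq> {}" if "j \<in> I" for j using that by blast
      have "B \<notin> F ` I" using v(1) by (auto simp: B_def)
      then have card: "card (insert B (F ` I)) = DIM('a) + 2"
        using finI I True by (simp add: card_image)
      have "\<Inter>(insert B (F ` I)) \<noteq> {}"
      proof (rule Helly)
        show "card (insert B (F ` I)) \<ge> DIM('a) + 1" using card by simp
        show "\<forall>s\<in>insert B (F ` I). convex s" using cc by (auto simp: B_def)
      next
        fix t assume t: "t \<subseteq> insert B (F ` I)" "card t = DIM('a) + 1"
        then obtain X where X: "X \<in> insert B (F ` I)" "X \<notin> t"
          using card by (metis add_left_imp_eq numeral_eq_one_iff semiring_norm(85) subsetI subset_antisym)
        show "\<Inter>t \<noteq> {}"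
        proof (cases "X = B")
          case True
          then have "t \<subseteq> F ` I" using t(1) X by blast
          then show ?thesis using ne by blast
        next
          case False
          then obtain j where j: "j \<in> I" "X = F j" using X by blast
          then have "t \<subseteq> insert B (F ` (I - {j}))" using t(1) X by blast
          then have "(\<Inter>i\<in>I - {j}. F i) \<inter> B \<subseteq> \<Inter>t" by blast
          then show ?thesis using meet[OF j(1)] by blast
        qed
      qed
      then obtain y where "y \<in> B" "y \<in> (\<Inter>i\<in>I. F i)" by auto
      then show False using v(2)[of y] by (simp add: B_def)
    qed
    then obtain j where j: "j \<in> I" "(\<Inter>i\<in>I - {j}. F i) \<inter> B = {}" by blast
    have "v = closest_point (\<Inter>i\<in>I - {j}. F i) a"
    proof (rule closest_point_unique)
      show "\<forall>z\<in>\<Inter>i\<in>I - {j}. F i. dist a v \<le> dist a z"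
        using j(2) by (fastforce simp: B_def)
    qed (use cl[of "I - {j}"] v(1) in auto)
    then show ?thesis using j(1) v_def by metis
  qed
qed

text \<open>Choose one witness point for each subfamily with nonempty intersection and let
  \<open>G i\<close> be the convex hull of the finitely many witnesses of subfamilies containing
  \<open>i\<close>. Closest points need closed sets, whereas the given sets are only convex.\<close>

lemma compact_convex_shrinking:
  fixes F :: "'i \<Rightarrow> 'a::euclidean_space set"
  assumes "finite A" and conv: "\<And>i. i \<in> A \<Longrightarrow> convex (F i)"
  shows "\<exists>G. (\<forall>i. compact (G i)) \<and> (\<forall>i. convex (G i)) \<and> (\<forall>i\<in>A. G i \<subseteq> F i) \<and>
    (\<forall>T\<subseteq>A. (\<Inter>i\<in>T. F i) \<noteq> {} \<longrightarrow> (\<Inter>i\<in>T. G i) \<noteq> {})"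
proof (intro exI conjI allI ballI impI)
  define w where "w T = (SOME x. x \<in> (\<Inter>i\<in>T. F i))" for T
  have w: "w T \<in> (\<Inter>i\<in>T. F i)" if "(\<Inter>i\<in>T. F i) \<noteq> {}" for T
    unfolding w_def by (rule someI_ex) (use that in blast)
  define P where "P i = {T. T \<subseteq> A \<and> i \<in> T \<and> (\<Inter>i\<in>T. F i) \<noteq> {}}" for i
  have finP: "finite (P i)" for i
    by (rule finite_subset[of _ "Pow A"]) (use \<open>finite A\<close> in \<open>auto simp: P_def\<close>)
  show "compact (convex hull (w ` P i))" for i
    using finP by (simp add: finite_imp_compact_convex_hull)
  show "convex (convex hull (w ` P i))" for i by simp
  show "convex hull (w ` P i) \<subseteq> F i" if "i \<in> A" for i
  proof (rule hull_minimal)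
    show "w ` P i \<subseteq> F i"
    proof clarify
      fix T assume "T \<in> P i"
      then have "i \<in> T" "w T \<in> (\<Inter>i\<in>T. F i)" using w[of T] by (simp_all add: P_def)
      then show "w T \<in> F i" by blast
    qed
  qed (rule conv[OF that])
  show "(\<Inter>i\<in>T. convex hull (w ` P i)) \<noteq> {}" if "T \<subseteq> A" "(\<Inter>i\<in>T. F i) \<noteq> {}" for T
  proof -
    have "w T \<in> convex hull (w ` P i)" if "i \<in> T" for i
    proof (rule hull_inc)
      have "T \<in> P i" unfolding P_def using that \<open>T \<subseteq> A\<close> \<open>(\<Inter>i\<in>T. F i) \<noteq> {}\<close> by blast
      then show "w T \<in> w ` P i" by (rule imageI)
    qed
    then show ?thesis by blast
  qed
qed

theorem colorful_Helly:
  fixes F :: "'i \<Rightarrow> 'a::euclidean_space set" and D :: "nat \<Rightarrow> 'i set"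
  defines "k \<equiv> DIM('a) + 1"
  assumes D: "\<And>m. m < k \<Longrightarrow> finite (D m)" "\<And>m. m < k \<Longrightarrow> D m \<noteq> {}"
    and conv: "\<And>m i. m < k \<Longrightarrow> i \<in> D m \<Longrightarrow> convex (F i)"
    and rainbow: "\<And>h. h \<in> PiE {..<k} D \<Longrightarrow> (\<Inter>m<k. F (h m)) \<noteq> {}"
  shows "\<exists>m<k. (\<Inter>i\<in>D m. F i) \<noteq> {}"
proof -
  have "finite (\<Union>m<k. D m)" using D by auto
  moreover have "\<And>i. i \<in> (\<Union>m<k. D m) \<Longrightarrow> convex (F i)" using conv by auto
  ultimately obtain G where G: "\<And>i. compact (G i)" "\<And>i. convex (G i)"
    "\<And>i. i \<in> (\<Union>m<k. D m) \<Longrightarrow> G i \<subseteq> F i"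
    "\<And>T. T \<subseteq> (\<Union>m<k. D m) \<Longrightarrow> (\<Inter>i\<in>T. F i) \<noteq> {} \<Longrightarrow> (\<Inter>i\<in>T. G i) \<noteq> {}"
    using compact_convex_shrinking[of "\<Union>m<k. D m" F] by metis
  have G_rainbow: "(\<Inter>m<k. G (h m)) \<noteq> {}" if h: "h \<in> PiE {..<k} D" for h
  proof -
    have "(\<Inter>i\<in>h ` {..<k}. F i) \<noteq> {}" using rainbow[OF h] by (simp add: image_image)
    then have "(\<Inter>i\<in>h ` {..<k}. G i) \<noteq> {}" using h by (intro G(4)) auto
    then show ?thesis by (simp add: image_image)
  qed
  define v where "v h m = closest_point (\<Inter>m'\<in>{..<k} - {m}. G (h m')) 0" for h :: "nat \<Rightarrow> 'i" and m
  have cl: "closed (\<Inter>m'\<in>T. G (h m'))" "convex (\<Inter>m'\<in>T. G (h m'))" for h :: "nat \<Rightarrow> 'i" and T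
    using compact_imp_closed[OF G(1)] G(2) by (auto intro!: closed_INT convex_INT)
  \<comment> \<open>Choose a rainbow tuple with one color omitted whose closest point to 0 is as far as possible.
    That point lies in every member of the omitted class.\<close>
  define Z where "Z = PiE {..<k} D \<times> {..<k}"
  have finZ: "finite Z" using D by (auto simp: Z_def intro!: finite_PiE)
  have "PiE {..<k} D \<noteq> {}" using D(2) by (simp add: PiE_eq_empty_iff)
  then have "Z \<noteq> {}" by (auto simp: Z_def k_def)
  define g where "g z = norm (v (fst z) (snd z))" for z
  have "Max (g ` Z) \<in> g ` Z" using finZ \<open>Z \<noteq> {}\<close> by (intro Max_in) auto
  then obtain z where z: "z \<in> Z" "g z = Max (g ` Z)" by force
  have "g y \<le> g z" if "y \<in> Z" for y using finZ that z(2) by simp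
  with z(1) obtain h m where hm: "h \<in> PiE {..<k} D" "m < k"
    and max: "\<And>h' m'. h' \<in> PiE {..<k} D \<Longrightarrow> m' < k \<Longrightarrow> norm (v h' m') \<le> norm (v h m)"
    by (cases z) (force simp: Z_def g_def)
  have "v h m \<in> F x" if x: "x \<in> D m" for x
  proof -
    define h' where "h' = h(m := x)"
    have h': "h' \<in> PiE {..<k} D" using hm x by (auto simp: h'_def PiE_iff extensional_def)
    define w where "w = closest_point (\<Inter>m'<k. G (h' m')) 0"
    obtain j where j: "j < k" "v h' j = w"
      using critical_index[of "{..<k}" "\<lambda>m'. G (h' m')" 0] G(1,2) G_rainbow[OF h']
      unfolding w_def v_def k_def by (auto simp: compact_imp_closed)
    have w: "w \<in> (\<Inter>m'<k. G (h' m'))"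
      unfolding w_def using closest_point_in_set[OF cl(1) G_rainbow[OF h']] by simp
    then have w_mem: "w \<in> (\<Inter>m'\<in>{..<k} - {m}. G (h m'))" by (auto simp: h'_def split: if_splits)
    \<comment> \<open>Since \<open>w\<close> equals \<open>v h' j\<close>, maximality makes its norm
      at most that of \<open>v h m\<close>. So \<open>w\<close> is also a closest point for the
      tuple \<open>h\<close> with color \<open>m\<close> omitted, and uniqueness identifies it with
      \<open>v h m\<close>.\<close>
    have "dist 0 w \<le> dist 0 y" if "y \<in> (\<Inter>m'\<in>{..<k} - {m}. G (h m'))" for y
      using max[OF h' j(1)] closest_point_le[OF cl(1) that, of 0] j(2) by (auto simp: v_def)
    then have "w = v h m"
      unfolding v_def using w_mem by (intro closest_point_unique cl) auto
    moreover have "w \<in> G x" using w hm(2) by (auto simp: h'_def dest!: bspec[of _ _ m])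
    ultimately show ?thesis using G(3) x hm(2) by blast
  qed
  then show ?thesis using hm(2) by blast
qed

text \<open>Double counting: each intersecting (d+1)-tuple is charged to a d-subset \<open>S\<close>
  with the same closest point \<open>v S\<close>, together with the one further index, whose set
  contains \<open>v S\<close>. If no point lay in many sets, every \<open>S\<close> would be charged
  too rarely.\<close>

theorem fractional_Helly:
  fixes F :: "nat \<Rightarrow> 'a::euclidean_space set"
  assumes n: "n \<ge> DIM('a) + 1" and \<alpha>: "\<alpha> \<ge> 0"
    and conv: "\<And>i. i < n \<Longrightarrow> convex (F i)"
    and many: "real (card {I. I \<subseteq> {..<n} \<and> card I = DIM('a) + 1 \<and> (\<Inter>i\<in>I. F i) \<noteq> {}})
      \<ge> \<alpha> * real (n choose (DIM('a) + 1))"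
  shows "\<exists>p. real (card {i. i < n \<and> p \<in> F i}) \<ge> \<alpha> / (DIM('a) + 1) * n"
proof (rule ccontr)
  define d where "d = DIM('a)"
  assume "\<not> ?thesis"
  then have few: "real (card {i. i < n \<and> p \<in> F i}) < \<alpha> / (d + 1) * n" for p
    by (auto simp: d_def not_le)
  obtain G where G: "\<And>i. compact (G i)" "\<And>i. convex (G i)"
    "\<And>i. i \<in> {..<n} \<Longrightarrow> G i \<subseteq> F i"
    "\<And>T. T \<subseteq> {..<n} \<Longrightarrow> (\<Inter>i\<in>T. F i) \<noteq> {} \<Longrightarrow> (\<Inter>i\<in>T. G i) \<noteq> {}"
    using compact_convex_shrinking[of "{..<n}" F] conv by (metis finite_lessThan lessThan_iff)
  define v where "v S = closest_point (\<Inter>i\<in>S. G i) 0" for S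
  define \<S> where "\<S> = {S. S \<subseteq> {..<n} \<and> card S = d}"
  define E where "E = {I. I \<subseteq> {..<n} \<and> card I = d + 1 \<and> (\<Inter>i\<in>I. F i) \<noteq> {}}"
  define X where "X S = {i. i < n \<and> i \<notin> S \<and> v S \<in> F i}" for S
  \<comment> \<open>Only those \<open>S\<close> matter whose \<open>v S\<close> lies in all their
    sets: then the indices of the sets containing \<open>v S\<close> are exactly \<open>S\<close>
    and \<open>X S\<close>, so the bound \<open>few\<close> leaves fewer than
    \<open>\<alpha> / (d + 1) * n - d\<close> for \<open>X S\<close>.\<close>
  define \<S>' where "\<S>' = {S\<in>\<S>. v S \<in> (\<Inter>i\<in>S. F i)}"
  have fin: "finite \<S>" "finite \<S>'" by (simp_all add: \<S>_def \<S>'_def)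
  have finX: "finite (X S)" for S by (simp add: X_def)
  have "E \<subseteq> (\<lambda>(S, i). insert i S) ` (SIGMA S:\<S>'. X S)"
  proof
    fix I assume I: "I \<in> E"
    have neI: "(\<Inter>i\<in>I. G i) \<noteq> {}" using I G(4) by (auto simp: E_def)
    obtain j where j: "j \<in> I" "v (I - {j}) = v I"
      using critical_index[of I G 0] I G(1,2) neI
      by (auto simp: E_def d_def v_def compact_imp_closed)
    have "v I \<in> (\<Inter>i\<in>I. G i)"
      unfolding v_def using neI G(1) by (intro closest_point_in_set closed_INT) (auto intro: compact_imp_closed)
    then have vI: "v I \<in> (\<Inter>i\<in>I. F i)" using G(3) I by (fastforce simp: E_def)
    have "(I - {j}, j) \<in> (SIGMA S:\<S>'. X S)"
      using I j vI by (auto simp: E_def X_def \<S>_def \<S>'_def)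
    moreover have "I = insert j (I - {j})" using j(1) by blast
    ultimately show "I \<in> (\<lambda>(S, i). insert i S) ` (SIGMA S:\<S>'. X S)"
      by (metis (no_types, lifting) case_prod_conv image_eqI)
  qed
  then have "card E \<le> card (SIGMA S:\<S>'. X S)"
    using fin finX by (intro surj_card_le) auto
  also have "\<dots> = (\<Sum>S\<in>\<S>'. card (X S))" using fin finX by simp
  finally have E_le: "real (card E) \<le> (\<Sum>S\<in>\<S>'. real (card (X S)))"
    by (metis of_nat_le_iff of_nat_sum)
  have choose: "real (n choose (d + 1)) * (d + 1) = real (n choose d) * (n - d)"
  proof -
    have "(n choose (d + 1)) * (d + 1) = (n choose d) * (n - d)"
      using choose_mult[of d "d + 1" n] n by (simp add: d_def)
    then show ?thesis unfolding of_nat_mult[symmetric] by simp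
  qed
  have X_less: "real (card (X S)) < \<alpha> / (d + 1) * (n - d)" if "S \<in> \<S>'" "\<alpha> \<le> d + 1" for S
  proof -
    have S: "S \<subseteq> {..<n}" "card S = d" "v S \<in> (\<Inter>i\<in>S. F i)"
      using that by (auto simp: \<S>'_def \<S>_def)
    have "{i. i < n \<and> v S \<in> F i} = S \<union> X S" using S by (auto simp: X_def)
    moreover have "card (S \<union> X S) = d + card (X S)"
      using S finX finite_subset[OF S(1)] by (subst card_Un_disjoint) (auto simp: X_def)
    ultimately have "d + real (card (X S)) < \<alpha> / (d + 1) * n" using few[of "v S"] by simp
    \<comment> \<open>This weakens the bound \<open>\<alpha> / (d + 1) * n - d\<close> to
      \<open>\<alpha> / (d + 1) * (n - d)\<close>, the form that fits the identity
      \<open>choose\<close>.\<close>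
    moreover have "\<alpha> / (d + 1) * d \<le> 1 * real d"
      by (rule mult_right_mono) (use that(2) in \<open>auto simp: field_simps\<close>)
    moreover have "real (n - d) = real n - real d" using n by (simp add: d_def of_nat_diff)
    ultimately show ?thesis by (simp only: right_diff_distrib)
  qed
  have "0 < n" using n by simp
  have "\<alpha> \<noteq> 0" using few[of 0] by auto
  then have pos: "\<alpha> > 0" using \<alpha> by simp
  have cpos: "real (n choose (d + 1)) > 0" using n by (simp add: d_def)
  have E_ge: "real (card E) \<ge> \<alpha> * real (n choose (d + 1))"
    using many by (simp add: E_def d_def)
  have "card E \<le> n choose (d + 1)"
  proof -
    have "card E \<le> card {I. I \<subseteq> {..<n} \<and> card I = d + 1}"
      by (rule card_mono) (auto simp: E_def)
    then show ?thesis by (simp add: n_subsets)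
  qed
  then have "\<alpha> * real (n choose (d + 1)) \<le> 1 * real (n choose (d + 1))" using E_ge by linarith
  then have "\<alpha> \<le> 1" using cpos by (metis mult_le_cancel_right_pos)
  then have \<alpha>d: "\<alpha> \<le> d + 1" by simp
  \<comment> \<open>Needed for strictness: an empty sum would not give a strict inequality
    below.\<close>
  have "\<S>' \<noteq> {}"
    using E_le E_ge mult_pos_pos[OF pos cpos] by auto
  then have "(\<Sum>S\<in>\<S>'. real (card (X S))) < (\<Sum>S\<in>\<S>'. \<alpha> / (d + 1) * (n - d))"
    using X_less \<alpha>d fin by (intro sum_strict_mono) auto
  also have "\<dots> = card \<S>' * (\<alpha> / (d + 1) * (n - d))" by simp
  also have "\<dots> \<le> (n choose d) * (\<alpha> / (d + 1) * (n - d))"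
  proof (rule mult_right_mono)
    have "card \<S>' \<le> card \<S>" using fin by (intro card_mono) (auto simp: \<S>'_def)
    also have "card \<S> = n choose d" by (simp add: \<S>_def n_subsets)
    finally show "real (card \<S>') \<le> real (n choose d)" by simp
  qed (use pos n in \<open>auto simp: d_def\<close>)
  also have "\<dots> = \<alpha> * real (n choose (d + 1))"
    using choose by (simp add: field_simps)
  finally show False using E_le E_ge by linarith
qed

subsection \<open>Dense hypergraphs\<close>

text \<open>Counts the pairs \<open>I \<subseteq> V\<close> in two ways: each \<open>I\<close>
  extends to an \<open>M\<close>-set by choosing \<open>M - k\<close> of the remaining
  \<open>card A - k\<close> elements.\<close>

lemma sum_card_superset:
  assumes "finite A" and E: "\<And>I. I \<in> E \<Longrightarrow> I \<subseteq> A \<and> card I = k" and "k \<le> M"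
  shows "(\<Sum>V | V \<subseteq> A \<and> card V = M. card {I\<in>E. I \<subseteq> V}) = card E * ((card A - k) choose (M - k))"
proof -
  have finE: "finite E" by (rule finite_subset[of _ "Pow A"]) (use assms in auto)
  have "card {V \<in> {V. V \<subseteq> A \<and> card V = M}. I \<subseteq> V} = (card A - k) choose (M - k)" if "I \<in> E" for I
  proof -
    have I: "I \<subseteq> A" "card I = k" "finite I" using E[OF that] assms(1) finite_subset by auto
    have "bij_betw (\<lambda>U. U \<union> I) {U. U \<subseteq> A - I \<and> card U = M - k} {V. V \<subseteq> A \<and> card V = M \<and> I \<subseteq> V}"
    proof (rule bij_betw_byWitness[where f' = "\<lambda>V. V - I"])
      show "(\<lambda>U. U \<union> I) ` {U. U \<subseteq> A - I \<and> card U = M - k} \<subseteq> {V. V \<subseteq> A \<and> card V = M \<and> I \<subseteq> V}"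
      proof clarify
        fix U assume U: "U \<subseteq> A - I" "card U = M - k"
        have "card (U \<union> I) = card U + card I"
          using U I assms(1) by (intro card_Un_disjoint) (auto intro: finite_subset)
        then show "U \<union> I \<subseteq> A \<and> card (U \<union> I) = M \<and> I \<subseteq> U \<union> I" using U I assms(3) by auto
      qed
      show "(\<lambda>V. V - I) ` {V. V \<subseteq> A \<and> card V = M \<and> I \<subseteq> V} \<subseteq> {U. U \<subseteq> A - I \<and> card U = M - k}"
        using I by (auto simp: card_Diff_subset)
    qed auto
    then have "card {V. V \<subseteq> A \<and> card V = M \<and> I \<subseteq> V} = card {U. U \<subseteq> A - I \<and> card U = M - k}"
      by (simp add: bij_betw_same_card)
    also have "\<dots> = (card A - k) choose (M - k)"
      using assms(1) I by (simp add: n_subsets card_Diff_subset)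
    finally show ?thesis by (simp add: conj_assoc)
  qed
  then show ?thesis
    using assms(1) finE
    by (subst sum_multicount[of _ E "\<lambda>V I. I \<subseteq> V" "(card A - k) choose (M - k)"]) (auto simp: mult.commute)
qed

text \<open>Averaged over all \<open>M\<close>-sets, the density of \<open>E\<close> is at least
  \<alpha>, so at least a fraction \<open>\<alpha> / 2\<close> of them have density at least
  \<open>\<alpha> / 2\<close> and contain a member of \<open>\<G>\<close>. Each member is found in
  at most \<open>(n - r) choose (M - r)\<close> of these \<open>M\<close>-sets.\<close>

lemma supersaturation:
  assumes "finite A" and E: "\<And>I. I \<in> E \<Longrightarrow> I \<subseteq> A \<and> card I = k"
    and \<G>: "\<And>G. G \<in> \<G> \<Longrightarrow> G \<subseteq> A \<and> card G = r"
    and M: "k \<le> M" "r \<le> M" "M \<le> card A"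
    and dense: "real (card E) \<ge> \<alpha> * real (card A choose k)" and "\<alpha> \<ge> 0"
    and local_dense: "\<And>V. V \<subseteq> A \<Longrightarrow> card V = M \<Longrightarrow>
      real (card {I\<in>E. I \<subseteq> V}) \<ge> \<alpha> / 2 * real (M choose k) \<Longrightarrow> \<exists>G\<in>\<G>. G \<subseteq> V"
  shows "real (card \<G>) \<ge> \<alpha> / 2 / real (M choose r) * real (card A choose r)"
proof -
  define n where "n = card A"
  define \<V> where "\<V> = {V. V \<subseteq> A \<and> card V = M}"
  define W where "W = {V\<in>\<V>. \<exists>G\<in>\<G>. G \<subseteq> V}"
  have fin: "finite \<V>" "finite W" using assms(1) by (simp_all add: \<V>_def W_def)
  have finG: "finite \<G>" by (rule finite_subset[of _ "Pow A"]) (use assms in auto)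
  have card\<V>: "card \<V> = n choose M" using assms(1) by (simp add: \<V>_def n_subsets n_def)
  have "\<alpha> * real (n choose M) * real (M choose k) = \<alpha> * real (n choose k) * real ((n - k) choose (M - k))"
    using choose_mult[of k M n] M by (simp add: n_def mult.assoc flip: of_nat_mult)
  also have "\<dots> \<le> real (card E) * real ((n - k) choose (M - k))"
    using dense by (intro mult_right_mono) (auto simp: n_def)
  also have "\<dots> = real (\<Sum>V\<in>\<V>. card {I\<in>E. I \<subseteq> V})"
    using sum_card_superset[of A E k M] E assms(1) M(1) by (simp add: \<V>_def n_def)
  also have "\<dots> = (\<Sum>V\<in>\<V>. real (card {I\<in>E. I \<subseteq> V}))" by simp
  \<comment> \<open>An \<open>M\<close>-set in \<open>W\<close> holds at most all
    \<open>M choose k\<close> edges; one outside \<open>W\<close> has density below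
    \<open>\<alpha> / 2\<close>.\<close>
  also have "\<dots> \<le> (\<Sum>V\<in>\<V>. (if V \<in> W then real (M choose k) else 0) + \<alpha> / 2 * real (M choose k))"
  proof (rule sum_mono)
    fix V assume V: "V \<in> \<V>"
    show "real (card {I\<in>E. I \<subseteq> V}) \<le> (if V \<in> W then real (M choose k) else 0) + \<alpha> / 2 * real (M choose k)"
    proof (cases "V \<in> W")
      case True
      have finV: "finite V" using V assms(1) finite_subset by (auto simp: \<V>_def)
      have "card {I\<in>E. I \<subseteq> V} \<le> card {I. I \<subseteq> V \<and> card I = k}"
        using finV E by (intro card_mono) auto
      also have "\<dots> = M choose k" using finV V by (simp add: n_subsets \<V>_def)
      finally show ?thesis using True \<open>\<alpha> \<ge> 0\<close> by (simp add: add_increasing2)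
    next
      case False
      then have "\<not> real (card {I\<in>E. I \<subseteq> V}) \<ge> \<alpha> / 2 * real (M choose k)"
        using local_dense[of V] V by (auto simp: W_def \<V>_def)
      then show ?thesis using False by simp
    qed
  qed
  also have "\<dots> = real (card W) * real (M choose k) + real (n choose M) * (\<alpha> / 2 * real (M choose k))"
  proof -
    have "(\<Sum>V\<in>\<V>. if V \<in> W then real (M choose k) else 0) = (\<Sum>V\<in>W. real (M choose k))"
      using fin by (intro sum.mono_neutral_cong_right) (auto simp: W_def)
    then show ?thesis by (simp add: sum.distrib card\<V>)
  qed
  finally have "(\<alpha> / 2 * real (n choose M)) * real (M choose k) \<le> real (card W) * real (M choose k)"
    by (simp add: algebra_simps)
  moreover have "real (M choose k) > 0" using M(1) by simp
  ultimately have W_ge: "\<alpha> / 2 * real (n choose M) \<le> real (card W)"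
    by (metis mult_le_cancel_right_pos)
  have "card W = (\<Sum>V\<in>W. 1)" by simp
  also have "\<dots> \<le> (\<Sum>V\<in>W. card {G\<in>\<G>. G \<subseteq> V})"
    using finG by (intro sum_mono) (auto simp: W_def Suc_le_eq card_gt_0_iff)
  also have "\<dots> \<le> (\<Sum>V\<in>\<V>. card {G\<in>\<G>. G \<subseteq> V})"
    using fin by (intro sum_mono2) (auto simp: W_def)
  also have "\<dots> = card \<G> * ((n - r) choose (M - r))"
    using sum_card_superset[of A \<G> r M] \<G> assms(1) M(2) by (simp add: \<V>_def n_def)
  finally have "real (card W) \<le> real (card \<G>) * real ((n - r) choose (M - r))"
    by (metis of_nat_le_iff of_nat_mult)
  then have "\<alpha> / 2 * real (n choose M) * real (M choose r) \<le> real (card \<G>) * real ((n - r) choose (M - r)) * real (M choose r)"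
    using W_ge by (intro mult_right_mono) auto
  then have "\<alpha> / 2 * (real (n choose M) * real (M choose r)) \<le> real (card \<G>) * real ((n - r) choose (M - r)) * real (M choose r)"
    by (simp only: mult.assoc)
  also have "real (n choose M) * real (M choose r) = real (n choose r) * real ((n - r) choose (M - r))"
    using choose_mult[of r M n] M by (simp add: n_def flip: of_nat_mult)
  finally have "(\<alpha> / 2 * real (n choose r)) * real ((n - r) choose (M - r))
     \<le> (real (card \<G>) * real (M choose r)) * real ((n - r) choose (M - r))"
    by (simp add: algebra_simps)
  moreover have "real ((n - r) choose (M - r)) > 0" using M by (simp add: n_def)
  ultimately have "\<alpha> / 2 * real (n choose r) \<le> real (card \<G>) * real (M choose r)"
    by (metis mult_le_cancel_right_pos)
  moreover have "real (M choose r) > 0" using M(2) by simp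
  ultimately show ?thesis by (simp add: n_def field_simps)
qed

text \<open>On average \<open>f\<close> is related to \<open>2 * \<epsilon> * card B\<close>
  elements of \<open>B\<close>, so a fraction \<epsilon> of all \<open>f\<close> have at least
  \<open>N\<close> of them. Picking \<open>N\<close> for each such \<open>f\<close> and applying the
  pigeonhole principle to the \<open>2 ^ card B\<close> subsets of \<open>B\<close> fixes a common
  choice \<open>T\<close>.\<close>

lemma dense_grid_step:
  fixes \<epsilon> :: real
  assumes A: "finite P" "finite B" "B \<noteq> {}" and P: "P \<noteq> {}" and "\<epsilon> > 0"
    and deg: "\<And>x. x \<in> B \<Longrightarrow> real (card {f\<in>P. R f x}) \<ge> 2 * \<epsilon> * real (card P)"
    and N: "real N \<le> \<epsilon> * real (card B)"
  shows "\<exists>T\<subseteq>B. card T = N \<and> real (card {f\<in>P. \<forall>x\<in>T. R f x}) \<ge> \<epsilon> / 2 ^ card B * real (card P)"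
proof -
  define nb where "nb f = {x\<in>B. R f x}" for f
  define G where "G = {f\<in>P. card (nb f) \<ge> N}"
  have finG: "finite G" using A by (simp add: G_def)
  have "real (card B) * (2 * \<epsilon> * real (card P)) = (\<Sum>x\<in>B. 2 * \<epsilon> * real (card P))" by simp
  also have "\<dots> \<le> (\<Sum>x\<in>B. real (card {f\<in>P. R f x}))"
    using deg by (rule sum_mono)
  also have "\<dots> = (\<Sum>f\<in>P. real (card (nb f)))"
    using sum_multicount_gen[OF A(1,2), of R "\<lambda>x. card {f\<in>P. R f x}"]
    by (simp add: nb_def flip: of_nat_sum)
  also have "\<dots> \<le> (\<Sum>f\<in>P. (if f \<in> G then real (card B) else 0) + real N)"
  proof (rule sum_mono)
    fix f assume "f \<in> P"
    moreover have "card (nb f) \<le> card B" using A(2) by (intro card_mono) (auto simp: nb_def)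
    ultimately show "real (card (nb f)) \<le> (if f \<in> G then real (card B) else 0) + real N"
      by (auto simp: G_def)
  qed
  also have "\<dots> = real (card G) * real (card B) + real (card P) * real N"
  proof -
    have "(\<Sum>f\<in>P. if f \<in> G then real (card B) else 0) = (\<Sum>f\<in>G. real (card B))"
      using A(1) by (intro sum.mono_neutral_cong_right) (auto simp: G_def)
    then show ?thesis by (simp add: sum.distrib)
  qed
  also have "real (card P) * real N \<le> real (card P) * (\<epsilon> * real (card B))"
    by (rule mult_left_mono[OF N]) simp
  finally have "(\<epsilon> * real (card P)) * real (card B) \<le> real (card G) * real (card B)"
    by (simp add: algebra_simps)
  moreover have "real (card B) > 0" using A by (simp add: card_gt_0_iff)
  ultimately have G_ge: "\<epsilon> * real (card P) \<le> real (card G)"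
    by (metis mult_le_cancel_right_pos)
  have "\<exists>T. T \<subseteq> nb f \<and> card T = N" if "f \<in> G" for f
    using that obtain_subset_with_card_n[of N "nb f"] by (auto simp: G_def)
  then obtain \<tau> where \<tau>: "\<And>f. f \<in> G \<Longrightarrow> \<tau> f \<subseteq> nb f \<and> card (\<tau> f) = N" by metis
  have "G \<noteq> {}"
    using G_ge A(1,3) \<open>\<epsilon> > 0\<close> by (metis card.empty card_gt_0_iff mult_pos_pos not_less of_nat_0 of_nat_0_less_iff P)
  obtain T where T: "T \<in> Pow B" "card (\<tau> -` {T} \<inter> G) * card (Pow B) \<ge> card G"
    using pigeonhole_card[of \<tau> G "Pow B"] \<tau> finG A(2) by (auto simp: nb_def)
  have "\<tau> -` {T} \<inter> G \<noteq> {}" 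
    using T(2) finG \<open>G \<noteq> {}\<close> by (metis card.empty card_0_eq le_zero_eq mult_0)
  then have "card T = N" using \<tau> by blast
  have "\<tau> -` {T} \<inter> G \<subseteq> {f\<in>P. \<forall>x\<in>T. R f x}" using \<tau> by (fastforce simp: nb_def G_def)
  then have "card (\<tau> -` {T} \<inter> G) \<le> card {f\<in>P. \<forall>x\<in>T. R f x}"
    using A(1) by (intro card_mono) auto
  then have "card G \<le> card {f\<in>P. \<forall>x\<in>T. R f x} * 2 ^ card B"
    using T(2) A(2) by (simp add: card_Pow) (meson le_trans mult_le_mono1)
  then have "real (card G) \<le> real (card {f\<in>P. \<forall>x\<in>T. R f x}) * 2 ^ card B"
    by (simp flip: of_nat_le_iff[where 'a = real])
  then have "\<epsilon> / 2 ^ card B * real (card P) \<le> real (card {f\<in>P. \<forall>x\<in>T. R f x})"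
    using G_ge by (simp add: field_simps)
  then show ?thesis using T(1) \<open>card T = N\<close> by auto
qed

text \<open>Induction on the number of parts: \<open>dense_grid_step\<close> finds \<open>N\<close>
  vertices \<open>T\<close> of the last part that jointly extend a positive fraction of the shorter
  tuples, and these tuples form the hypergraph for the induction hypothesis.\<close>

theorem dense_hypergraph_contains_grid:
  fixes \<epsilon> :: real
  assumes "\<epsilon> > 0"
  shows "\<exists>M. \<forall>(A :: nat \<Rightarrow> 'i set) H. (\<forall>m<k. finite (A m) \<and> M \<le> card (A m)) \<longrightarrow>
    H \<subseteq> PiE {..<k} A \<longrightarrow> real (card H) \<ge> \<epsilon> * real (\<Prod>m<k. card (A m)) \<longrightarrow>
    (\<exists>D. (\<forall>m<k. D m \<subseteq> A m \<and> card (D m) = N) \<and> PiE {..<k} D \<subseteq> H)"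
  using assms
proof (induction k arbitrary: \<epsilon>)
  case 0
  have "PiE {..<0} D \<subseteq> H" if "H \<subseteq> PiE {..<0} A" "real (card H) \<ge> \<epsilon> * real (\<Prod>m<0. card (A m))"
    for A D :: "nat \<Rightarrow> 'i set" and H
  proof -
    \<comment> \<open>The empty product is 1, so positive density forces \<open>H\<close> to contain
      the empty tuple.\<close>
    have "H \<noteq> {}" using that(2) 0 by auto
    then show ?thesis using that(1) by auto
  qed
  then show ?case by auto
next
  case (Suc k)
  \<comment> \<open>\<open>M0\<close> is large enough for \<open>dense_grid_step\<close> at density
    \<open>\<epsilon> / 4\<close>, and \<open>\<epsilon>'\<close> is the density left after its
    pigeonhole step on \<open>M0\<close> vertices.\<close>
  define M0 where "M0 = nat \<lceil>4 * real N / \<epsilon>\<rceil> + 1"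
  have "4 * real N / \<epsilon> \<le> real M0"
    using real_nat_ceiling_ge[of "4 * real N / \<epsilon>"] unfolding M0_def by linarith
  then have M0: "real N \<le> \<epsilon> / 4 * real M0" "M0 > 0"
    using Suc.prems by (auto simp: M0_def field_simps)
  define \<epsilon>' where "\<epsilon>' = \<epsilon> / 4 / 2 ^ M0"
  have "\<epsilon>' > 0" using Suc.prems by (simp add: \<epsilon>'_def)
  from Suc.IH[OF this] obtain M1 where M1: "\<And>(A :: nat \<Rightarrow> 'i set) H. (\<forall>m<k. finite (A m) \<and> M1 \<le> card (A m)) \<Longrightarrow>
    H \<subseteq> PiE {..<k} A \<Longrightarrow> real (card H) \<ge> \<epsilon>' * real (\<Prod>m<k. card (A m)) \<Longrightarrow>
    (\<exists>D. (\<forall>m<k. D m \<subseteq> A m \<and> card (D m) = N) \<and> PiE {..<k} D \<subseteq> H)" by metis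
  \<comment> \<open>The last term guarantees \<open>M0\<close> vertices of high degree in the last
    part; the 1 keeps all parts nonempty.\<close>
  define M where "M = max (max M1 1) (nat \<lceil>2 * real M0 / \<epsilon>\<rceil>)"
  have step: "\<exists>D. (\<forall>m<Suc k. D m \<subseteq> A m \<and> card (D m) = N) \<and> PiE {..<Suc k} D \<subseteq> H"
    if A: "\<forall>m<Suc k. finite (A m) \<and> M \<le> card (A m)" and H: "H \<subseteq> PiE {..<Suc k} A"
      and dense: "real (card H) \<ge> \<epsilon> * real (\<Prod>m<Suc k. card (A m))"
    for A :: "nat \<Rightarrow> 'i set" and H
  proof -
    define P where "P = PiE {..<k} A"
    have finP: "finite P" using A by (auto simp: P_def intro!: finite_PiE)
    have cardP: "card P = (\<Prod>m<k. card (A m))" by (simp add: P_def card_PiE)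
    have "card (A m) > 0" if "m < k" for m using A[rule_format, of m] that by (simp add: M_def)
    then have "card P > 0" by (auto simp: cardP intro!: prod_pos)
    then have "P \<noteq> {}" by auto
    define R where "R f x \<longleftrightarrow> f(k := x) \<in> H" for f x
    have finA: "finite (A k)" "M \<le> card (A k)" using A by auto
    define X where "X = {x\<in>A k. real (card {f\<in>P. R f x}) \<ge> \<epsilon> / 2 * real (card P)}"
    have H_sub: "H \<subseteq> (\<lambda>(x, f). f(k := x)) ` (SIGMA x:A k. {f\<in>P. R f x})"
    proof
      fix h assume "h \<in> H"
      then have "h \<in> (\<lambda>(x, f). f(k := x)) ` (A k \<times> P)"
        using H by (auto simp: lessThan_Suc PiE_insert_eq P_def)
      then obtain x f where "x \<in> A k" "f \<in> P" "h = f(k := x)" by auto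
      then show "h \<in> (\<lambda>(x, f). f(k := x)) ` (SIGMA x:A k. {f\<in>P. R f x})"
        using \<open>h \<in> H\<close> by (intro image_eqI[of _ _ "(x, f)"]) (auto simp: R_def)
    qed
    have "real (card H) \<le> (\<Sum>x\<in>A k. real (card {f\<in>P. R f x}))"
    proof -
      have "card H \<le> card (SIGMA x:A k. {f\<in>P. R f x})"
        using finA finP by (intro surj_card_le[OF _ H_sub]) auto
      also have "\<dots> = (\<Sum>x\<in>A k. card {f\<in>P. R f x})" using finA finP by simp
      finally show ?thesis by (metis of_nat_le_iff of_nat_sum)
    qed
    also have "\<dots> \<le> (\<Sum>x\<in>A k. (if x \<in> X then real (card P) else 0) + \<epsilon> / 2 * real (card P))"
    proof (rule sum_mono)
      fix x assume "x \<in> A k"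
      moreover have "card {f\<in>P. R f x} \<le> card P" using finP by (intro card_mono) auto
      ultimately show "real (card {f\<in>P. R f x}) \<le> (if x \<in> X then real (card P) else 0) + \<epsilon> / 2 * real (card P)"
        using Suc.prems by (auto simp: X_def add_increasing2)
    qed
    also have "\<dots> = real (card X) * real (card P) + real (card (A k)) * (\<epsilon> / 2 * real (card P))"
    proof -
      have "(\<Sum>x\<in>A k. if x \<in> X then real (card P) else 0) = (\<Sum>x\<in>X. real (card P))"
        using finA by (intro sum.mono_neutral_cong_right) (auto simp: X_def)
      then show ?thesis by (simp add: sum.distrib)
    qed
    finally have "\<epsilon> * (real (card P) * real (card (A k))) \<le>
        real (card X) * real (card P) + real (card (A k)) * (\<epsilon> / 2 * real (card P))"
      using dense by (simp add: cardP)
    then have "(\<epsilon> / 2 * real (card (A k))) * real (card P) \<le> real (card X) * real (card P)"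
      by (simp add: algebra_simps)
    then have "\<epsilon> / 2 * real (card (A k)) \<le> real (card X)"
      using \<open>card P > 0\<close> by (metis mult_le_cancel_right_pos of_nat_0_less_iff)
    moreover have "real M0 \<le> \<epsilon> / 2 * real (card (A k))"
    proof -
      have "2 * real M0 / \<epsilon> \<le> real M"
        using real_nat_ceiling_ge[of "2 * real M0 / \<epsilon>"] by (simp add: M_def)
      then have "2 * real M0 / \<epsilon> \<le> real (card (A k))" using finA by linarith
      then show ?thesis using Suc.prems by (simp add: field_simps)
    qed
    ultimately have "M0 \<le> card X" by linarith
    \<comment> \<open>Cutting \<open>X\<close> down to exactly \<open>M0\<close> vertices keeps the
      pigeonhole loss independent of the size of \<open>A k\<close>.\<close>
    then obtain B where B: "B \<subseteq> X" "card B = M0" using obtain_subset_with_card_n by metis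
    have finB: "finite B" "B \<noteq> {}" using B(2) M0(2) card_gt_0_iff by metis+
    have "real (card {f\<in>P. R f x}) \<ge> 2 * (\<epsilon> / 4) * real (card P)" if "x \<in> B" for x
      using B(1) that by (auto simp: X_def)
    then obtain T where T: "T \<subseteq> B" "card T = N"
      "real (card {f\<in>P. \<forall>x\<in>T. R f x}) \<ge> \<epsilon> / 4 / 2 ^ card B * real (card P)"
      using dense_grid_step[of P B "\<epsilon> / 4" R N] finP finB \<open>P \<noteq> {}\<close> B(2) M0 Suc.prems by auto
    have "\<exists>D. (\<forall>m<k. D m \<subseteq> A m \<and> card (D m) = N) \<and> PiE {..<k} D \<subseteq> {f\<in>P. \<forall>x\<in>T. R f x}"
      using A T(3) B(2) by (intro M1) (auto simp: M_def P_def \<epsilon>'_def card_PiE)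
    then obtain D where D: "\<forall>m<k. D m \<subseteq> A m \<and> card (D m) = N" "PiE {..<k} D \<subseteq> {f\<in>P. \<forall>x\<in>T. R f x}"
      by blast
    have "PiE {..<k} (D(k := T)) = PiE {..<k} D" by (rule PiE_cong) auto
    then have "PiE {..<Suc k} (D(k := T)) \<subseteq> H"
      using D(2) by (auto simp: lessThan_Suc PiE_insert_eq R_def)
    moreover have "\<forall>m<Suc k. (D(k := T)) m \<subseteq> A m \<and> card ((D(k := T)) m) = N"
      using D(1) T B(1) by (auto simp: less_Suc_eq X_def)
    ultimately show ?thesis by blast
  qed
  show ?case by (rule exI[of _ M], intro allI impI, rule step; assumption)
qed

subsection \<open>Wide intersections\<close>

text \<open>The signed difference makes the condition linear in the pair \<open>(p, q)\<close>,
  hence a halfspace in the product space. The empty set is never wide, even for negative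
  \<open>l\<close>.\<close>

definition wide :: "'a::real_inner \<Rightarrow> real \<Rightarrow> 'a set \<Rightarrow> bool" where
  "wide b l S \<longleftrightarrow> (\<exists>p\<in>S. \<exists>q\<in>S. l \<le> (q - p) \<bullet> b)"

lemma wide_mono: "wide b l S \<Longrightarrow> S \<subseteq> T \<Longrightarrow> l' \<le> l \<Longrightarrow> wide b l' T"
  unfolding wide_def by (meson order_trans subsetD)

text \<open>The segment from \<open>p\<close> to \<open>q\<close> extends over at least
  \<open>2 * l' + 2 * c\<close> in direction \<open>b\<close>, and the open slab around level
  \<open>s\<close> covers at most \<open>2 * c\<close> of it. So at one of the two ends a piece of
  extent \<open>l'\<close> lies outside the slab.\<close>

lemma wide_split:
  assumes "convex S" and "wide b l S" and "0 < l'" "0 \<le> c" "2 * l' + 2 * c \<le> l"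
  shows "wide b l' (S \<inter> {x. x \<bullet> b \<le> s - c}) \<or> wide b l' (S \<inter> {x. s + c \<le> x \<bullet> b})"
proof -
  obtain p q where pq: "p \<in> S" "q \<in> S" "l \<le> (q - p) \<bullet> b" using assms(2) by (auto simp: wide_def)
  define u where "u = l' / ((q - p) \<bullet> b)"
  have u: "0 \<le> u" "u \<le> 1" "u * ((q - p) \<bullet> b) = l'"
    using pq(3) assms(3-5) by (auto simp: u_def divide_le_eq_1)
  show ?thesis
  proof (cases "p \<bullet> b \<le> s - c - l'")
    case True
    define r where "r = (1 - u) *\<^sub>R p + u *\<^sub>R q"
    have "r \<in> S" unfolding r_def using assms(1) pq u by (intro convexD_alt) auto
    moreover have r: "r \<bullet> b = p \<bullet> b + l'"
      using u(3) by (simp add: r_def algebra_simps)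
    ultimately have "wide b l' (S \<inter> {x. x \<bullet> b \<le> s - c})"
      unfolding wide_def using True pq(1) assms(3)
      by (intro bexI[of _ p] bexI[of _ r]) (auto simp: inner_diff_left)
    then show ?thesis ..
  next
    case False
    define r where "r = (1 - u) *\<^sub>R q + u *\<^sub>R p"
    have "r \<in> S" unfolding r_def using assms(1) pq u by (intro convexD_alt) auto
    moreover have r: "r \<bullet> b = q \<bullet> b - l'"
      using u(3) by (simp add: r_def algebra_simps)
    ultimately have "wide b l' (S \<inter> {x. s + c \<le> x \<bullet> b})"
      unfolding wide_def using False pq assms(3-5)
      by (intro bexI[of _ r] bexI[of _ q]) (auto simp: inner_diff_left)
    then show ?thesis ..
  qed
qed

section \<open>Wide subfamilies from grids by repeated slab removal\<close>

text \<open>One of the two properties holds for at least half of all tuples, so the grid theorem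
  applies with density \<open>1 / 2\<close>.\<close>

lemma two_colored_grid:
  "\<exists>M. \<forall>(A :: nat \<Rightarrow> 'i set) Q R. (\<forall>m<k. finite (A m) \<and> M \<le> card (A m)) \<longrightarrow>
    (\<forall>h\<in>PiE {..<k} A. Q h \<or> R h) \<longrightarrow>
    (\<exists>D. (\<forall>m<k. D m \<subseteq> A m \<and> card (D m) = N) \<and>
      ((\<forall>h\<in>PiE {..<k} D. Q h) \<or> (\<forall>h\<in>PiE {..<k} D. R h)))"
proof -
  obtain M where M: "\<And>(A :: nat \<Rightarrow> 'i set) H. (\<forall>m<k. finite (A m) \<and> M \<le> card (A m)) \<Longrightarrow>
    H \<subseteq> PiE {..<k} A \<Longrightarrow> real (card H) \<ge> (1 / 2) * real (\<Prod>m<k. card (A m)) \<Longrightarrow>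
    (\<exists>D. (\<forall>m<k. D m \<subseteq> A m \<and> card (D m) = N) \<and> PiE {..<k} D \<subseteq> H)"
    using dense_hypergraph_contains_grid[of "1 / 2" k N] by (metis half_gt_zero zero_less_one)
  have step: "\<exists>D. (\<forall>m<k. D m \<subseteq> A m \<and> card (D m) = N) \<and>
      ((\<forall>h\<in>PiE {..<k} D. Q h) \<or> (\<forall>h\<in>PiE {..<k} D. R h))"
    if A: "\<forall>m<k. finite (A m) \<and> M \<le> card (A m)" and QR: "\<forall>h\<in>PiE {..<k} A. Q h \<or> R h"
    for A :: "nat \<Rightarrow> 'i set" and Q R
  proof -
    define H where "H X = {h\<in>PiE {..<k} A. X h}" for X
    have fin: "finite (PiE {..<k} A)" using A by (auto intro!: finite_PiE)
    have "PiE {..<k} A = H Q \<union> H R" using QR by (auto simp: H_def)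
    then have "(\<Prod>m<k. card (A m)) \<le> card (H Q) + card (H R)"
      using card_Un_le[of "H Q" "H R"] by (simp add: card_PiE flip: card_PiE)
    then have "real (card (H Q)) \<ge> (1 / 2) * real (\<Prod>m<k. card (A m)) \<or>
        real (card (H R)) \<ge> (1 / 2) * real (\<Prod>m<k. card (A m))"
      by linarith
    then obtain X where X: "X = Q \<or> X = R" "real (card (H X)) \<ge> (1 / 2) * real (\<Prod>m<k. card (A m))"
      by blast
    obtain D where "\<forall>m<k. D m \<subseteq> A m \<and> card (D m) = N" "PiE {..<k} D \<subseteq> H X"
      using M[OF A _ X(2)] by (auto simp: H_def)
    then show ?thesis using X(1) by (intro exI[of _ D]) (auto simp: H_def)
  qed
  show ?thesis by (rule exI[of _ M], intro allI impI, rule step; assumption)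
qed

lemma wide_subfamily_of_two_points:
  assumes "finite D" "t \<le> card D" "y \<in> (\<Inter>i\<in>D. F i)" "w \<in> (\<Inter>i\<in>D. F i)" "c \<le> \<bar>(y - w) \<bullet> b\<bar>"
  shows "\<exists>G\<subseteq>D. card G = t \<and> wide b c (\<Inter>i\<in>G. F i)"
proof -
  obtain G where G: "G \<subseteq> D" "card G = t" using obtain_subset_with_card_n[OF assms(2)] by blast
  have "c \<le> (y - w) \<bullet> b \<or> c \<le> (w - y) \<bullet> b"
    using assms(5) by (auto simp: abs_if inner_diff_left split: if_splits)
  moreover have "y \<in> (\<Inter>i\<in>G. F i)" "w \<in> (\<Inter>i\<in>G. F i)" using G(1) assms by auto
  ultimately have "wide b c (\<Inter>i\<in>G. F i)" unfolding wide_def by blast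
  then show ?thesis using G by blast
qed

text \<open>Wide sets are nonempty, so the colorful Helly theorem applies to the sets
  \<open>F i \<inter> U\<close>; as the class is nonempty, its common point lies in
  \<open>U\<close>.\<close>

lemma color_class_meets_region:
  fixes F :: "'i \<Rightarrow> 'a::euclidean_space set"
  defines "k \<equiv> DIM('a) + 1"
  assumes "convex U" "\<And>m. m < k \<Longrightarrow> finite (D m) \<and> D m \<noteq> {}"
    and "\<And>m i. m < k \<Longrightarrow> i \<in> D m \<Longrightarrow> convex (F i)"
    and rainbow: "\<And>h. h \<in> PiE {..<k} D \<Longrightarrow> wide b l ((\<Inter>m<k. F (h m)) \<inter> U)"
  shows "\<exists>m<k. \<exists>y\<in>U. y \<in> (\<Inter>i\<in>D m. F i)"
proof -
  have "(\<Inter>m<k. F (h m) \<inter> U) \<noteq> {}" if "h \<in> PiE {..<k} D" for h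
    using rainbow[OF that] by (auto simp: wide_def)
  then have "\<exists>m<k. (\<Inter>i\<in>D m. F i \<inter> U) \<noteq> {}"
    using assms(2-4) unfolding k_def by (intro colorful_Helly) (auto intro: convex_Int)
  then obtain m y where "m < k" "y \<in> (\<Inter>i\<in>D m. F i \<inter> U)" by blast
  moreover have "D m \<noteq> {}" using assms(3) \<open>m < k\<close> by blast
  ultimately show ?thesis by blast
qed

text \<open>\<open>W\<close> is the set of colors whose classes already have a common point far from the
  region \<open>U\<close>, and \<open>u\<close> bounds the number of remaining colors. The colorful Helly theorem yields a
  class with a common point \<open>y\<close> in \<open>U\<close>. If its color is in \<open>W\<close>, the two points finish the proof.
  Otherwise cut out a slab around \<open>y\<close> and pass to a subgrid whose rainbow intersections are all
  wide on the same side of it. Each such step costs at most a factor 4 in width.\<close>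
lemma wide_color_class_in_region:
  fixes t u :: nat
  defines "k \<equiv> DIM('a::euclidean_space) + 1"
  shows "\<exists>N. \<forall>(F :: 'i \<Rightarrow> 'a set) D U W b c. 0 < c \<longrightarrow> convex U \<longrightarrow>
    (\<forall>m<k. finite (D m) \<and> N \<le> card (D m)) \<longrightarrow>
    (\<forall>m<k. \<forall>i\<in>D m. convex (F i)) \<longrightarrow>
    (\<forall>h\<in>PiE {..<k} D. wide b (4 ^ u * c) ((\<Inter>m<k. F (h m)) \<inter> U)) \<longrightarrow>
    W \<subseteq> {..<k} \<longrightarrow> k \<le> card W + u \<longrightarrow>
    (\<forall>m\<in>W. \<exists>w\<in>\<Inter>i\<in>D m. F i. \<forall>y\<in>U. c \<le> \<bar>(y - w) \<bullet> b\<bar>) \<longrightarrow>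
    (\<exists>m<k. \<exists>G\<subseteq>D m. card G = t \<and> wide b c (\<Inter>i\<in>G. F i))"
    (is "\<exists>N. ?P u N")
proof (induction u)
  case 0
  have step: "\<exists>m<k. \<exists>G\<subseteq>D m. card G = t \<and> wide b c (\<Inter>i\<in>G. F i)"
    if "convex U" and D: "\<forall>m<k. finite (D m) \<and> max t 1 \<le> card (D m)"
      and conv: "\<forall>m<k. \<forall>i\<in>D m. convex (F i)"
      and rainbow: "\<forall>h\<in>PiE {..<k} D. wide b (4 ^ 0 * c) ((\<Inter>m<k. F (h m)) \<inter> U)"
      and W: "W \<subseteq> {..<k}" "k \<le> card W + 0"
      and w: "\<forall>m\<in>W. \<exists>w\<in>\<Inter>i\<in>D m. F i. \<forall>y\<in>U. c \<le> \<bar>(y - w) \<bullet> b\<bar>"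
    for F :: "'i \<Rightarrow> 'a set" and D U W b c
  proof -
    have ne: "\<And>m. m < k \<Longrightarrow> finite (D m) \<and> D m \<noteq> {}" using D by fastforce
    have "\<exists>m<k. \<exists>y\<in>U. y \<in> (\<Inter>i\<in>D m. F i)"
      by (rule color_class_meets_region[of U D F b "4 ^ 0 * c", folded k_def])
        (use \<open>convex U\<close> ne conv rainbow in blast)+
    then obtain m y where m: "m < k" "y \<in> U" "y \<in> (\<Inter>i\<in>D m. F i)" by blast
    \<comment> \<open>With \<open>u = 0\<close> every color has been found before, so the class just
      found provides two far points.\<close>
    have "W = {..<k}" using W by (intro card_seteq) auto
    then obtain w where "w \<in> (\<Inter>i\<in>D m. F i)" "c \<le> \<bar>(y - w) \<bullet> b\<bar>" using w m by blast
    then show ?thesis using wide_subfamily_of_two_points[of "D m" t y F w c b] D m by auto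
  qed
  show ?case by (rule exI[of _ "max t 1"], intro allI impI, rule step; assumption)
next
  case (Suc u)
  from Suc.IH obtain N where N: "?P u N" ..
  show ?case
    using two_colored_grid[where 'i = 'i and k = k and N = N]
  proof (elim exE, goal_cases)
    case (1 M)
    note M = this[rule_format]
    have step: "\<exists>m<k. \<exists>G\<subseteq>D m. card G = t \<and> wide b c (\<Inter>i\<in>G. F i)"
      if "0 < c" "convex U" and D: "\<forall>m<k. finite (D m) \<and> max (max t 1) M \<le> card (D m)"
        and conv: "\<forall>m<k. \<forall>i\<in>D m. convex (F i)"
        and rainbow: "\<forall>h\<in>PiE {..<k} D. wide b (4 ^ Suc u * c) ((\<Inter>m<k. F (h m)) \<inter> U)"
        and W: "W \<subseteq> {..<k}" "k \<le> card W + Suc u"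
        and w: "\<forall>m\<in>W. \<exists>w\<in>\<Inter>i\<in>D m. F i. \<forall>y\<in>U. c \<le> \<bar>(y - w) \<bullet> b\<bar>"
      for F :: "'i \<Rightarrow> 'a set" and D U W b c
    proof -
      have ne: "\<And>m. m < k \<Longrightarrow> finite (D m) \<and> D m \<noteq> {}" using D by fastforce
      have "\<exists>m<k. \<exists>y\<in>U. y \<in> (\<Inter>i\<in>D m. F i)"
        by (rule color_class_meets_region[of U D F b "4 ^ Suc u * c", folded k_def])
          (use \<open>convex U\<close> ne conv rainbow in blast)+
      then obtain m y where m: "m < k" "y \<in> U" "y \<in> (\<Inter>i\<in>D m. F i)" by blast
      show ?thesis
      proof (cases "m \<in> W")
        case True
        then obtain w where "w \<in> (\<Inter>i\<in>D m. F i)" "c \<le> \<bar>(y - w) \<bullet> b\<bar>" using w m by blast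
        then show ?thesis using wide_subfamily_of_two_points[of "D m" t y F w c b] D m by auto
      next
        case False
        define L where "L = U \<inter> {x. x \<bullet> b \<le> y \<bullet> b - c}"
        define R where "R = U \<inter> {x. y \<bullet> b + c \<le> x \<bullet> b}"
        have split: "wide b (4 ^ u * c) ((\<Inter>m<k. F (h m)) \<inter> L) \<or> wide b (4 ^ u * c) ((\<Inter>m<k. F (h m)) \<inter> R)"
          if h: "h \<in> PiE {..<k} D" for h
        proof -
          have "convex ((\<Inter>m<k. F (h m)) \<inter> U)"
            using conv h \<open>convex U\<close> by (intro convex_Int convex_INT) (auto simp: PiE_iff)
          \<comment> \<open>The origin of the factor 4: two pieces of width \<open>4 ^ u * c\<close>
            and a slab of width \<open>2 * c\<close> must fit into the old width, which holds since
            \<open>4 ^ u\<close> is at least 1.\<close>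
          moreover have "2 * (4 ^ u * c) + 2 * c \<le> 4 ^ Suc u * c"
            using mult_right_mono[OF one_le_power[of "4::real" u], of c] \<open>0 < c\<close> by simp
          ultimately show ?thesis
            using wide_split[of "(\<Inter>m<k. F (h m)) \<inter> U" b "4 ^ Suc u * c" "4 ^ u * c" c "y \<bullet> b"] rainbow h \<open>0 < c\<close>
            by (simp add: L_def R_def Int_assoc)
        qed
        have "\<exists>D'. (\<forall>m<k. D' m \<subseteq> D m \<and> card (D' m) = N) \<and>
          ((\<forall>h\<in>PiE {..<k} D'. wide b (4 ^ u * c) ((\<Inter>m<k. F (h m)) \<inter> L)) \<or>
           (\<forall>h\<in>PiE {..<k} D'. wide b (4 ^ u * c) ((\<Inter>m<k. F (h m)) \<inter> R)))"
          by (intro M split) (use D in auto)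
        then obtain D' where D': "\<forall>m<k. D' m \<subseteq> D m \<and> card (D' m) = N"
          "(\<forall>h\<in>PiE {..<k} D'. wide b (4 ^ u * c) ((\<Inter>m<k. F (h m)) \<inter> L)) \<or>
           (\<forall>h\<in>PiE {..<k} D'. wide b (4 ^ u * c) ((\<Inter>m<k. F (h m)) \<inter> R))"
          by blast
        obtain U' where U': "U' = L \<or> U' = R" 
          and rainbow': "\<forall>h\<in>PiE {..<k} D'. wide b (4 ^ u * c) ((\<Inter>m<k. F (h m)) \<inter> U')"
          using D'(2) by blast
        have "{x. x \<bullet> b \<le> s} = {x. b \<bullet> x \<le> s}" "{x. s \<le> x \<bullet> b} = {x. b \<bullet> x \<ge> s}" for s
          by (auto simp: inner_commute)
        then have "convex U'"
          using U' \<open>convex U\<close> by (auto simp: L_def R_def intro!: convex_Int convex_halfspace_le convex_halfspace_ge)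
        have sub: "U' \<subseteq> U" using U' by (auto simp: L_def R_def)
        have far: "c \<le> \<bar>(z - y) \<bullet> b\<bar>" if "z \<in> U'" for z
          using U' that by (auto simp: L_def R_def inner_diff_left)
        have "card (insert m W) = Suc (card W)"
          using False W(1) finite_subset by (auto intro!: card_insert_disjoint)
        then have "k \<le> card (insert m W) + u" using W(2) by simp
        \<comment> \<open>The new color \<open>m\<close> gets \<open>y\<close> as its far point, as
          \<open>U'\<close> avoids the slab around \<open>y\<close>. Old far points survive because
          both the classes and the region only shrink.\<close>
        moreover have "\<forall>m'\<in>insert m W. \<exists>w\<in>\<Inter>i\<in>D' m'. F i. \<forall>y\<in>U'. c \<le> \<bar>(y - w) \<bullet> b\<bar>"
        proof
          fix m' assume m': "m' \<in> insert m W"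
          then have "m' < k" using m W(1) by auto
          then have INT: "(\<Inter>i\<in>D m'. F i) \<subseteq> (\<Inter>i\<in>D' m'. F i)" using D'(1) by blast
          show "\<exists>w\<in>\<Inter>i\<in>D' m'. F i. \<forall>y\<in>U'. c \<le> \<bar>(y - w) \<bullet> b\<bar>"
          proof (cases "m' = m")
            case True
            then show ?thesis using m(3) subsetD[OF INT] far by (intro bexI[of _ y]) auto
          next
            case False
            then have "m' \<in> W" using m' by blast
            then obtain w' where w': "w' \<in> (\<Inter>i\<in>D m'. F i)" "\<forall>y\<in>U. c \<le> \<bar>(y - w') \<bullet> b\<bar>"
              using w by blast
            show ?thesis using subsetD[OF INT w'(1)] w'(2) sub by (intro bexI[of _ w']) auto
          qed
        qed
        moreover have "finite (D' m)" if "m < k" for m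
          by (rule finite_subset[of _ "D m"]) (use D D'(1) that in auto)
        then have "\<forall>m<k. finite (D' m) \<and> N \<le> card (D' m)" using D'(1) by simp
        moreover have "\<forall>m<k. \<forall>i\<in>D' m. convex (F i)" using conv D'(1) by blast
        moreover have "insert m W \<subseteq> {..<k}" using W(1) m(1) by simp
        ultimately have "\<exists>m<k. \<exists>G\<subseteq>D' m. card G = t \<and> wide b c (\<Inter>i\<in>G. F i)"
          by (intro N[rule_format, of c U' D' F b "insert m W"])
            (use \<open>0 < c\<close> \<open>convex U'\<close> rainbow' in blast)+
        then obtain m' G where "m' < k" "G \<subseteq> D' m'" "card G = t" "wide b c (\<Inter>i\<in>G. F i)"
          by blast
        then show ?thesis using D'(1) by blast
      qed
    qed
    show ?case by (rule exI[of _ "max (max t 1) M"], intro allI impI, rule step; assumption)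
  qed
qed

text \<open>The hypergraph \<open>E\<close> becomes \<open>k\<close>-partite by taking
  \<open>k\<close> copies of \<open>V\<close> as parts and the enumerations of edges as tuples. In a
  grid inside it the slab argument starts with the whole space and no color found.\<close>

lemma wide_subfamily:
  fixes \<alpha> :: real and t :: nat
  defines "k \<equiv> DIM('a::euclidean_space) + 1"
  assumes "\<alpha> > 0"
  shows "\<exists>M\<ge>max k t. \<forall>(F :: 'i \<Rightarrow> 'a set) V E b c. 0 < c \<longrightarrow> card V = M \<longrightarrow>
    (\<forall>i\<in>V. convex (F i)) \<longrightarrow>
    (\<forall>I\<in>E. I \<subseteq> V \<and> card I = k \<and> wide b (4 ^ k * c) (\<Inter>i\<in>I. F i)) \<longrightarrow>
    \<alpha> * real (M choose k) \<le> real (card E) \<longrightarrow>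
    (\<exists>G\<subseteq>V. card G = t \<and> wide b c (\<Inter>i\<in>G. F i))"
  using wide_color_class_in_region[where 'a = 'a and 'i = 'i and t = t and u = k, folded k_def]
proof (elim exE, goal_cases)
  case (1 N)
  note N = this[rule_format]
  have "k > 0" by (simp add: k_def)
  \<comment> \<open>The estimate \<open>(M / k) ^ k \<le> M choose k\<close> turns density \<alpha>
    among \<open>k\<close>-sets into density \<open>\<alpha> / k ^ k\<close> among all
    \<open>k\<close>-tuples.\<close>
  define \<epsilon> where "\<epsilon> = \<alpha> / real k ^ k"
  have "\<epsilon> > 0" using assms(2) \<open>k > 0\<close> by (simp add: \<epsilon>_def)
  then obtain M1 where M1: "\<And>(A :: nat \<Rightarrow> 'i set) H. (\<forall>m<k. finite (A m) \<and> M1 \<le> card (A m)) \<Longrightarrow>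
    H \<subseteq> PiE {..<k} A \<Longrightarrow> real (card H) \<ge> \<epsilon> * real (\<Prod>m<k. card (A m)) \<Longrightarrow>
    (\<exists>D. (\<forall>m<k. D m \<subseteq> A m \<and> card (D m) = N) \<and> PiE {..<k} D \<subseteq> H)"
    using dense_hypergraph_contains_grid[of \<epsilon> k N] by metis
  define M where "M = max M1 (max k t)"
  have step: "\<exists>G\<subseteq>V. card G = t \<and> wide b c (\<Inter>i\<in>G. F i)"
    if "0 < c" and V: "card V = M" and conv: "\<forall>i\<in>V. convex (F i)"
      and E: "\<forall>I\<in>E. I \<subseteq> V \<and> card I = k \<and> wide b (4 ^ k * c) (\<Inter>i\<in>I. F i)"
      and dense: "\<alpha> * real (M choose k) \<le> real (card E)"
    for F :: "'i \<Rightarrow> 'a set" and V E b c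
  proof -
    have finV: "finite V" using V \<open>k > 0\<close> by (intro card_ge_0_finite) (simp add: M_def)
    define H where "H = {h\<in>PiE {..<k} (\<lambda>_. V). h ` {..<k} \<in> E}"
    have finH: "finite H" using finV by (auto simp: H_def intro!: finite_PiE)
    have "E \<subseteq> (\<lambda>h. h ` {..<k}) ` H"
    proof
      fix I assume I: "I \<in> E"
      then have IV: "I \<subseteq> V" "card I = k" using E by auto
      moreover from this have "finite I" using finV finite_subset by blast
      ultimately obtain g where g: "bij_betw g {..<k} I"
        using finite_same_card_bij[of "{..<k}" I] by auto
      define h where "h = restrict g {..<k}"
      have "h ` {..<k} = I" using g by (auto simp: h_def bij_betw_def)
      moreover from this have "h \<in> PiE {..<k} (\<lambda>_. V)" using IV(1) by (auto simp: h_def)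
      ultimately show "I \<in> (\<lambda>h. h ` {..<k}) ` H" using I by (auto simp: H_def)
    qed
    then have "card E \<le> card H" using finH by (rule surj_card_le[rotated])
    moreover have "\<epsilon> * real (M ^ k) \<le> \<alpha> * real (M choose k)"
    proof -
      have "(real M / real k) ^ k \<le> real (M choose k)"
        by (rule binomial_ge_n_over_k_pow_k) (simp add: M_def)
      then have "\<alpha> * (real M / real k) ^ k \<le> \<alpha> * real (M choose k)"
        using assms(2) by (intro mult_left_mono) auto
      then show ?thesis by (simp add: \<epsilon>_def power_divide)
    qed
    ultimately have "real (card H) \<ge> \<epsilon> * real (\<Prod>m<k. card V)" using dense V by simp
    then obtain D where D: "\<forall>m<k. D m \<subseteq> V \<and> card (D m) = N" "PiE {..<k} D \<subseteq> H"
      using M1[of "\<lambda>_. V" H] finV V by (auto simp: H_def M_def)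
    have "wide b (4 ^ k * c) ((\<Inter>m<k. F (h m)) \<inter> UNIV)" if "h \<in> PiE {..<k} D" for h
    proof -
      have "h ` {..<k} \<in> E" using that D(2) by (auto simp: H_def)
      then have "wide b (4 ^ k * c) (\<Inter>i\<in>h ` {..<k}. F i)" using E by blast
      then show ?thesis by (simp add: image_image)
    qed
    moreover have "finite (D m)" if "m < k" for m
      by (rule finite_subset[OF _ finV]) (use D(1) that in auto)
    then have "\<forall>m<k. finite (D m) \<and> N \<le> card (D m)" using D(1) by simp
    moreover have "\<forall>m<k. \<forall>i\<in>D m. convex (F i)" using conv D(1) by blast
    ultimately have "\<exists>m<k. \<exists>G\<subseteq>D m. card G = t \<and> wide b c (\<Inter>i\<in>G. F i)"
      using \<open>0 < c\<close> by (intro N[of c UNIV D F b "{}"]) auto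
    then obtain m G where "m < k" "G \<subseteq> D m" "card G = t" "wide b c (\<Inter>i\<in>G. F i)"
      by blast
    then show ?thesis using D(1) by blast
  qed
  have "max k t \<le> M" by (simp add: M_def)
  show ?case
    by (rule exI[of _ M], rule conjI[OF \<open>max k t \<le> M\<close>], intro allI impI, rule step; assumption)
qed

section \<open>From diameter to width, and linear-size wide subfamilies\<close>

text \<open>The supremum need not be attained, so two points at distance above \<open>1 / 2\<close>
  are taken; their difference has l1 norm above \<open>1 / 2\<close>, so some coordinate contributes
  at least the average share.\<close>

lemma wide_in_coordinate_of_ediam:
  fixes S :: "'a::euclidean_space set"
  assumes "ediam S \<ge> 1"
  shows "\<exists>b\<in>Basis. wide b (1 / (2 * DIM('a))) S"
proof -
  have "ereal (1 / 2) < ediam S" using assms by (rule less_le_trans[rotated]) simp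
  then obtain p q where pq: "p \<in> S" "q \<in> S" "1 / 2 < dist p q"
    unfolding ediam_def by (auto simp: less_SUP_iff)
  have "\<exists>b\<in>Basis. 1 / (2 * DIM('a)) \<le> \<bar>(q - p) \<bullet> b\<bar>"
  proof (rule ccontr)
    assume "\<not> ?thesis"
    then have "(\<Sum>b\<in>Basis. \<bar>(q - p) \<bullet> b\<bar>) < (\<Sum>b\<in>(Basis :: 'a set). 1 / (2 * DIM('a)))"
      by (intro sum_strict_mono) auto
    moreover have "(\<Sum>b\<in>(Basis :: 'a set). 1 / (2 * real DIM('a))) = 1 / 2" by simp
    ultimately show False using norm_le_l1[of "q - p"] pq(3) by (simp add: dist_norm norm_minus_commute)
  qed
  then obtain b where b: "b \<in> Basis" "1 / (2 * DIM('a)) \<le> \<bar>(q - p) \<bullet> b\<bar>" ..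
  then have "1 / (2 * DIM('a)) \<le> (q - p) \<bullet> b \<or> 1 / (2 * DIM('a)) \<le> (p - q) \<bullet> b"
    by (auto simp: abs_if inner_diff_left split: if_splits)
  then show ?thesis using pq b(1) unfolding wide_def by blast
qed

lemma ediam_ge_of_wide:
  fixes S :: "'a::euclidean_space set"
  assumes "wide b c S" "b \<in> Basis"
  shows "ediam S \<ge> ereal c"
proof -
  obtain p q where pq: "p \<in> S" "q \<in> S" "c \<le> (q - p) \<bullet> b" using assms(1) by (auto simp: wide_def)
  have "(q - p) \<bullet> b \<le> dist p q"
    using Basis_le_norm[OF assms(2), of "q - p"] by (simp add: dist_norm norm_minus_commute)
  then have "ereal c \<le> ereal (dist (fst (p, q)) (snd (p, q)))" using pq(3) by simp
  also have "\<dots> \<le> ediam S"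
    unfolding ediam_def using pq(1,2) by (intro SUP_upper) auto
  finally show ?thesis .
qed

text \<open>A pair \<open>(p, q)\<close> witnessing width is a point of the product space, of
  dimension \<open>2 * DIM('a)\<close>. The fractional Helly theorem there requires tuples of size
  \<open>2 * DIM('a) + 1\<close>.\<close>

lemma fractional_Helly_wide:
  fixes F :: "nat \<Rightarrow> 'a::euclidean_space set"
  assumes n: "n \<ge> 2 * DIM('a) + 1" and \<gamma>: "\<gamma> \<ge> 0" and conv: "\<And>i. i < n \<Longrightarrow> convex (F i)"
    and many: "real (card {G. G \<subseteq> {..<n} \<and> card G = 2 * DIM('a) + 1 \<and> wide b c (\<Inter>i\<in>G. F i)})
      \<ge> \<gamma> * real (n choose (2 * DIM('a) + 1))"
  shows "\<exists>J\<subseteq>{..<n}. real (card J) \<ge> \<gamma> / (2 * DIM('a) + 1) * n \<and> (J \<noteq> {} \<longrightarrow> wide b c (\<Inter>i\<in>J. F i))"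
proof -
  define K where "K i = (F i \<times> F i) \<inter> {z. c \<le> (snd z - fst z) \<bullet> b}" for i
  have "convex {z :: 'a \<times> 'a. c \<le> (snd z - fst z) \<bullet> b}"
  proof -
    have "(snd z - fst z) \<bullet> b = (-b, b) \<bullet> z" for z :: "'a \<times> 'a"
      by (cases z) (simp add: inner_diff_left inner_commute[of b])
    then show ?thesis using convex_halfspace_ge[of c "(-b, b)"] by simp
  qed
  then have convK: "convex (K i)" if "i < n" for i
    using conv[OF that] by (auto simp: K_def intro: convex_Int convex_Times)
  \<comment> \<open>For empty \<open>G\<close> the right side is always true, whereas the left side
    fails for \<open>b = 0\<close> and positive \<open>c\<close>.\<close>
  have wide_iff: "wide b c (\<Inter>i\<in>G. F i) \<longleftrightarrow> (\<Inter>i\<in>G. K i) \<noteq> {}" if "G \<noteq> {}" for G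
  proof -
    have "z \<in> (\<Inter>i\<in>G. K i) \<longleftrightarrow> fst z \<in> (\<Inter>i\<in>G. F i) \<and> snd z \<in> (\<Inter>i\<in>G. F i) \<and> c \<le> (snd z - fst z) \<bullet> b" for z
      using that by (auto simp: K_def mem_Times_iff)
    then show ?thesis unfolding wide_def ex_in_conv[symmetric] by (metis fst_conv snd_conv)
  qed
  have dim: "DIM('a \<times> 'a) = 2 * DIM('a)" by simp
  have "G \<noteq> {}" if "card G = 2 * DIM('a) + 1" for G :: "nat set" using that by auto
  then have "{G. G \<subseteq> {..<n} \<and> card G = DIM('a \<times> 'a) + 1 \<and> (\<Inter>i\<in>G. K i) \<noteq> {}} =
      {G. G \<subseteq> {..<n} \<and> card G = 2 * DIM('a) + 1 \<and> wide b c (\<Inter>i\<in>G. F i)}"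
    unfolding dim using wide_iff by blast
  then have "real (card {G. G \<subseteq> {..<n} \<and> card G = DIM('a \<times> 'a) + 1 \<and> (\<Inter>i\<in>G. K i) \<noteq> {}})
      \<ge> \<gamma> * real (n choose (DIM('a \<times> 'a) + 1))"
    using many by (simp only: dim)
  moreover have "n \<ge> DIM('a \<times> 'a) + 1" using n by (simp only: dim)
  ultimately have "\<exists>z. real (card {i. i < n \<and> z \<in> K i}) \<ge> \<gamma> / (DIM('a \<times> 'a) + 1) * n"
    using \<gamma> convK by (intro fractional_Helly)
  then obtain z where z: "real (card {i. i < n \<and> z \<in> K i}) \<ge> \<gamma> / (2 * DIM('a) + 1) * n"
    unfolding dim by auto
  define J where "J = {i. i < n \<and> z \<in> K i}"
  have "J \<subseteq> {..<n}" by (auto simp: J_def)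
  moreover have "real (card J) \<ge> \<gamma> / (2 * DIM('a) + 1) * n"
    using z by (simp only: J_def)
  moreover have "wide b c (\<Inter>i\<in>J. F i)" if "J \<noteq> {}"
    using wide_iff[OF that] by (auto simp: J_def)
  ultimately show ?thesis by blast
qed

text \<open>Dense \<open>M\<close>-sets contain a wide tuple of size \<open>r\<close>, so
  supersaturation makes a positive fraction of all \<open>r\<close>-tuples wide, which is the input
  of \<open>fractional_Helly_wide\<close>.\<close>

lemma linear_wide_subfamily:
  fixes \<alpha> :: real
  defines "k \<equiv> DIM('a::euclidean_space) + 1"
  assumes "\<alpha> > 0"
  shows "\<exists>\<beta>>0. \<forall>n (F :: nat \<Rightarrow> 'a set) b c. 0 < c \<longrightarrow> k \<le> n \<longrightarrow> (\<forall>i<n. convex (F i)) \<longrightarrow>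
    \<alpha> * real (n choose k) \<le> real (card {I. I \<subseteq> {..<n} \<and> card I = k \<and> wide b (4 ^ k * c) (\<Inter>i\<in>I. F i)}) \<longrightarrow>
    (\<exists>J\<subseteq>{..<n}. \<beta> * real n \<le> real (card J) \<and> wide b c (\<Inter>i\<in>J. F i))"
proof -
  define r where "r = 2 * DIM('a) + 1"
  have "\<alpha> / 2 > 0" using assms(2) by simp
  then have "\<exists>M\<ge>max k r. \<forall>(F :: nat \<Rightarrow> 'a set) V E b c. 0 < c \<longrightarrow> card V = M \<longrightarrow>
    (\<forall>i\<in>V. convex (F i)) \<longrightarrow>
    (\<forall>I\<in>E. I \<subseteq> V \<and> card I = k \<and> wide b (4 ^ k * c) (\<Inter>i\<in>I. F i)) \<longrightarrow>
    \<alpha> / 2 * real (M choose k) \<le> real (card E) \<longrightarrow>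
    (\<exists>G\<subseteq>V. card G = r \<and> wide b c (\<Inter>i\<in>G. F i))"
    unfolding k_def by (rule wide_subfamily)
  then obtain M where M: "max k r \<le> M" and "\<forall>(F :: nat \<Rightarrow> 'a set) V E b c. 0 < c \<longrightarrow> card V = M \<longrightarrow>
    (\<forall>i\<in>V. convex (F i)) \<longrightarrow>
    (\<forall>I\<in>E. I \<subseteq> V \<and> card I = k \<and> wide b (4 ^ k * c) (\<Inter>i\<in>I. F i)) \<longrightarrow>
    \<alpha> / 2 * real (M choose k) \<le> real (card E) \<longrightarrow>
    (\<exists>G\<subseteq>V. card G = r \<and> wide b c (\<Inter>i\<in>G. F i))" by (elim exE conjE)
  note wideM = this(2)[rule_format]
  have Mpos: "M > 0" "k > 0" using M by (auto simp: r_def k_def)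
  define \<gamma> where "\<gamma> = \<alpha> / 2 / real (M choose r)"
  have "\<gamma> > 0" using assms(2) M by (simp add: \<gamma>_def)
  \<comment> \<open>The bound \<open>1 / M\<close> covers \<open>n < M\<close>, where a single wide
    \<open>k\<close>-tuple already has at least \<open>\<beta> * n\<close> members.\<close>
  define \<beta> where "\<beta> = min (1 / M) (\<gamma> / (2 * DIM('a) + 1))"
  have "\<beta> > 0" using \<open>\<gamma> > 0\<close> Mpos by (simp add: \<beta>_def)
  have step: "\<exists>J\<subseteq>{..<n}. \<beta> * real n \<le> real (card J) \<and> wide b c (\<Inter>i\<in>J. F i)"
    if "0 < c" "k \<le> n" and conv: "\<forall>i<n. convex (F i)"
      and many: "\<alpha> * real (n choose k) \<le> real (card {I. I \<subseteq> {..<n} \<and> card I = k \<and> wide b (4 ^ k * c) (\<Inter>i\<in>I. F i)})"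
    for n and F :: "nat \<Rightarrow> 'a set" and b c
  proof -
    define E where "E = {I. I \<subseteq> {..<n} \<and> card I = k \<and> wide b (4 ^ k * c) (\<Inter>i\<in>I. F i)}"
    have E_ge: "\<alpha> * real (n choose k) \<le> real (card E)" using many by (simp add: E_def)
    show ?thesis
    proof (cases "n < M")
      case True
      have "0 < \<alpha> * real (n choose k)" using assms(2) \<open>k \<le> n\<close> by simp
      then have "card E \<noteq> 0" using E_ge by linarith
      then have "E \<noteq> {}" by auto
      then obtain I where I: "I \<subseteq> {..<n}" "card I = k" "wide b (4 ^ k * c) (\<Inter>i\<in>I. F i)"
        by (auto simp: E_def)
      have "\<beta> * real n \<le> 1 / M * real n" by (rule mult_right_mono) (simp_all add: \<beta>_def)
      also have "\<dots> \<le> 1" using True by simp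
      also have "1 \<le> real (card I)" using I(2) Mpos by simp
      finally have "\<beta> * real n \<le> real (card I)" .
      moreover have "wide b c (\<Inter>i\<in>I. F i)"
      proof (rule wide_mono[OF I(3)])
        show "c \<le> 4 ^ k * c"
          using mult_right_mono[OF one_le_power[of "4::real" k], of c] \<open>0 < c\<close> by simp
      qed simp
      ultimately show ?thesis using I(1) by blast
    next
      case False
      define \<G> where "\<G> = {G. G \<subseteq> {..<n} \<and> card G = r \<and> wide b c (\<Inter>i\<in>G. F i)}"
      have "real (card \<G>) \<ge> \<alpha> / 2 / real (M choose r) * real (card {..<n} choose r)"
      proof (rule supersaturation[where E = E and k = k])
        fix V assume V: "V \<subseteq> {..<n}" "card V = M"
          "real (card {I\<in>E. I \<subseteq> V}) \<ge> \<alpha> / 2 * real (M choose k)"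
        have "\<exists>G\<subseteq>V. card G = r \<and> wide b c (\<Inter>i\<in>G. F i)"
          by (rule wideM[OF \<open>0 < c\<close> V(2) _ _ V(3)]) (use V(1) conv in \<open>auto simp: E_def\<close>)
        then obtain G where "G \<subseteq> V" "card G = r" "wide b c (\<Inter>i\<in>G. F i)" by blast
        then show "\<exists>G\<in>\<G>. G \<subseteq> V" using V(1) by (intro bexI[of _ G]) (auto simp: \<G>_def)
      qed (use M False E_ge assms(2) in \<open>auto simp: E_def \<G>_def\<close>)
      then have "real (card {G. G \<subseteq> {..<n} \<and> card G = 2 * DIM('a) + 1 \<and> wide b c (\<Inter>i\<in>G. F i)})
          \<ge> \<gamma> * real (n choose (2 * DIM('a) + 1))"
        by (simp add: \<G>_def \<gamma>_def r_def)
      then have "\<exists>J\<subseteq>{..<n}. real (card J) \<ge> \<gamma> / (2 * DIM('a) + 1) * n \<and> (J \<noteq> {} \<longrightarrow> wide b c (\<Inter>i\<in>J. F i))"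
        using M False conv \<open>\<gamma> > 0\<close> by (intro fractional_Helly_wide) (auto simp: r_def)
      then obtain J where J: "J \<subseteq> {..<n}" "real (card J) \<ge> \<gamma> / (2 * DIM('a) + 1) * n"
        "J \<noteq> {} \<longrightarrow> wide b c (\<Inter>i\<in>J. F i)" by blast
      have "\<beta> * real n \<le> \<gamma> / (2 * DIM('a) + 1) * real n"
        by (rule mult_right_mono) (simp_all add: \<beta>_def)
      then have J_ge: "\<beta> * real n \<le> real (card J)" using J(2) by linarith
      have "0 < \<beta> * real n" using \<open>\<beta> > 0\<close> \<open>k \<le> n\<close> Mpos by simp
      then have "J \<noteq> {}" using J_ge by auto
      then show ?thesis using J J_ge by blast
    qed
  qed
  show ?thesis
    by (rule exI[of _ \<beta>], rule conjI[OF \<open>\<beta> > 0\<close>], intro allI impI, rule step; assumption)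
qed

theorem theorem4:
  "\<exists>c>0. \<forall>\<alpha>::real. 0 < \<alpha> \<and> \<alpha> < 1 \<longrightarrow>
     (\<exists>\<beta>>0. \<forall>(n::nat) (F :: nat \<Rightarrow> 'a::euclidean_space set).
        n \<ge> DIM('a) + 1 \<longrightarrow>
        (\<forall>i<n. convex (F i)) \<longrightarrow>
        real (card {I. I \<subseteq> {..<n} \<and> card I = DIM('a) + 1 \<and> ediam (\<Inter>i\<in>I. F i) \<ge> 1})
          \<ge> \<alpha> * real (n choose (DIM('a) + 1)) \<longrightarrow>
        (\<exists>J \<subseteq> {..<n}. real (card J) \<ge> \<beta> * real n \<and> ediam (\<Inter>i\<in>J. F i) \<ge> ereal c))"
proof -
  define k where "k = DIM('a) + 1"
  \<comment> \<open>The width \<open>1 / (2 * DIM('a))\<close> comes from passing to a coordinate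
    direction, the divisor \<open>4 ^ k\<close> from the slab argument. Neither depends on
    \<alpha>.\<close>
  define c where "c = 1 / (2 * real DIM('a)) / 4 ^ k"
  have "c > 0" by (simp add: c_def)
  have width: "4 ^ k * c = 1 / (2 * real DIM('a))" by (simp add: c_def)
  have main: "\<exists>\<beta>>0. \<forall>(n::nat) (F :: nat \<Rightarrow> 'a::euclidean_space set).
        n \<ge> k \<longrightarrow> (\<forall>i<n. convex (F i)) \<longrightarrow>
        real (card {I. I \<subseteq> {..<n} \<and> card I = k \<and> ediam (\<Inter>i\<in>I. F i) \<ge> 1}) \<ge> \<alpha> * real (n choose k) \<longrightarrow>
        (\<exists>J \<subseteq> {..<n}. real (card J) \<ge> \<beta> * real n \<and> ediam (\<Inter>i\<in>J. F i) \<ge> ereal c)"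
    if "0 < \<alpha>" for \<alpha> :: real
  proof -
    \<comment> \<open>Fixing the most frequent coordinate direction costs a factor
      \<open>DIM('a)\<close> in density.\<close>
    have "\<alpha> / DIM('a) > 0" using that by simp
    from linear_wide_subfamily[where 'a = 'a, OF this, folded k_def] show ?thesis
    proof (elim exE conjE, goal_cases)
      case (1 \<beta>)
      note \<beta> = this(2)[rule_format]
      have step: "\<exists>J \<subseteq> {..<n}. real (card J) \<ge> \<beta> * real n \<and> ediam (\<Inter>i\<in>J. F i) \<ge> ereal c"
        if "k \<le> n" and conv: "\<forall>i<n. convex (F i)"
          and many: "real (card {I. I \<subseteq> {..<n} \<and> card I = k \<and> ediam (\<Inter>i\<in>I. F i) \<ge> 1}) \<ge> \<alpha> * real (n choose k)"
        for n and F :: "nat \<Rightarrow> 'a set"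
      proof -
        define E where "E b = {I. I \<subseteq> {..<n} \<and> card I = k \<and> wide b (4 ^ k * c) (\<Inter>i\<in>I. F i)}" for b
        have finE: "finite (E b)" for b by (rule finite_subset[of _ "Pow {..<n}"]) (auto simp: E_def)
        have "{I. I \<subseteq> {..<n} \<and> card I = k \<and> ediam (\<Inter>i\<in>I. F i) \<ge> 1} \<subseteq> (\<Union>b\<in>Basis. E b)"
          using wide_in_coordinate_of_ediam unfolding E_def width by fastforce
        then have "card {I. I \<subseteq> {..<n} \<and> card I = k \<and> ediam (\<Inter>i\<in>I. F i) \<ge> 1} \<le> card (\<Union>b\<in>Basis. E b)"
          using finE by (intro card_mono) auto
        also have "\<dots> \<le> (\<Sum>b\<in>Basis. card (E b))" by (rule card_UN_le) simp
        finally have "\<alpha> * real (n choose k) \<le> (\<Sum>b\<in>Basis. real (card (E b)))"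
          using many by (simp flip: of_nat_sum)
        moreover have "(\<Sum>b\<in>(Basis :: 'a set). \<alpha> / DIM('a) * real (n choose k)) = \<alpha> * real (n choose k)"
          by simp
        ultimately have "\<exists>b\<in>Basis. \<alpha> / DIM('a) * real (n choose k) \<le> real (card (E b))"
          using sum_strict_mono[of Basis "\<lambda>b. real (card (E b))" "\<lambda>b. \<alpha> / DIM('a) * real (n choose k)"]
          by (metis finite_Basis nonempty_Basis not_less)
        then obtain b where b: "b \<in> Basis" "\<alpha> / DIM('a) * real (n choose k) \<le> real (card (E b))" ..
        have "\<exists>J\<subseteq>{..<n}. \<beta> * real n \<le> real (card J) \<and> wide b c (\<Inter>i\<in>J. F i)"
          using \<beta>[OF \<open>c > 0\<close> \<open>k \<le> n\<close>] conv b(2) by (simp add: E_def)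
        then show ?thesis using ediam_ge_of_wide[OF _ b(1)] by blast
      qed
      show ?case
        by (rule exI[of _ \<beta>], rule conjI[OF 1(1)], intro allI impI, rule step; assumption)
    qed
  qed
  show ?thesis
    using \<open>c > 0\<close> main unfolding k_def by blast
qed

end
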